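(* Let $n\ge 4$. The set $\widehat{\mathcal{ID}}\left(\mathfrak{Reg}(\mathcal{E}_{\lozenge_n})\right)=\mathcal{ID}\left(\mathfrak{Reg}(\mathcal{E}_{\lozenge_n})\right)\cup\mathcal{AC}(\mathcal{E}_{\lozenge_n})$ is a subsemiring with zero of $\mathcal{E}_{\lozenge_n}$. The right ideal $\mathcal{AC}(\mathcal{E}_{\lozenge_n})$ of $\mathcal{E}_{\lozenge_n}$ is an ideal of this semiring.
   Context: A semiring is a set with a commutative associative addition and an associative multiplication satisfying both distributive laws (no zero or identity is required); a subsemiring is a nonempty subset closed under both operations; a right ideal $I$ of $R$ is a nonempty subset closed under addition with $IR\subseteq I$; an ideal satisfies in addition $RI\subseteq I$. A zero is an additively neutral element $0$ with $0x=x0=0$ for all $x$. For $n\ge 4$, $\lozenge_n$ is the lattice with $n$ elements $0,1,a_1,\dots,a_{n-2}$, where $0$ is the least element, $1$ is the greatest element and $a_1,\dots,a_{n-2}$ are pairwise incomparable (so $a_i\vee a_j=1$ for $i\ne j$). $\mathcal{E}_{\lozenge_n}$ is the semiring of all maps $\alpha:\lozenge_n\to\lozenge_n$ with $\alpha(x\vee y)=\alpha(x)\vee\alpha(y)$ and $\alpha(0)=0$, with operations $(\alpha+\beta)(x)=\alpha(x)\vee\beta(x)$ and $(\alpha\cdot\beta)(x)=\beta(\alpha(x))$. For $c\in\lozenge_n$, $\overline{c}$ denotes the map sending $0$ to $0$ and every other element to $c$. $\mathcal{AC}(\mathcal{E}_{\lozenge_n})=\{\overline{0},\overline{1},\overline{a_1},\dots,\overline{a_{n-2}}\}$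 is the set of almost constant endomorphisms. $\mathfrak{Reg}(\mathcal{E}_{\lozenge_n})$ is the set of regular endomorphisms, i.e. those that are neither $\overline{0}$ nor zero-divisors; equivalently, those $\alpha\in\mathcal{E}_{\lozenge_n}$ with $\alpha(x)\neq 0$ for all $x\ne 0$ and $\alpha\neq\overline{a_i}$ for all $i=1,\dots,n-2$. $\mathcal{ID}\left(\mathfrak{Reg}(\mathcal{E}_{\lozenge_n})\right)$ is the set of all $\alpha\in\mathfrak{Reg}(\mathcal{E}_{\lozenge_n})$ with $\alpha\cdot\alpha=\alpha$. *)

theory Defs
  imports Main "HOL-Library.FuncSet"
begin

subsection \<open>Semirings without required zero or identity\<close>

record 'a semiring_struct =
  carrier :: "'a set"
  add :: "'a \<Rightarrow> 'a \<Rightarrow> 'a"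
  mul :: "'a \<Rightarrow> 'a \<Rightarrow> 'a"

locale semiring_on =
  fixes R :: "'a semiring_struct"
  assumes nonempty: "carrier R \<noteq> {}"
    and add_closed: "\<lbrakk>x \<in> carrier R; y \<in> carrier R\<rbrakk> \<Longrightarrow> add R x y \<in> carrier R"
    and mul_closed: "\<lbrakk>x \<in> carrier R; y \<in> carrier R\<rbrakk> \<Longrightarrow> mul R x y \<in> carrier R"
    and add_comm: "\<lbrakk>x \<in> carrier R; y \<in> carrier R\<rbrakk> \<Longrightarrow> add R x y = add R y x"
    and add_assoc: "\<lbrakk>x \<in> carrier R; y \<in> carrier R; z \<in> carrier R\<rbrakk>
      \<Longrightarrow> add R (add R x y) z = add R x (add R y z)"
    and mul_assoc: "\<lbrakk>x \<in> carrier R; y \<in> carrier R; z \<in> carrier R\<rbrakk>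
      \<Longrightarrow> mul R (mul R x y) z = mul R x (mul R y z)"
    and distrib_left: "\<lbrakk>x \<in> carrier R; y \<in> carrier R; z \<in> carrier R\<rbrakk>
      \<Longrightarrow> mul R x (add R y z) = add R (mul R x y) (mul R x z)"
    and distrib_right: "\<lbrakk>x \<in> carrier R; y \<in> carrier R; z \<in> carrier R\<rbrakk>
      \<Longrightarrow> mul R (add R x y) z = add R (mul R x z) (mul R y z)"

locale subsemiring = semiring_on R for S :: "'a set" and R +
  assumes sub_nonempty: "S \<noteq> {}"
    and sub_subset: "S \<subseteq> carrier R"
    and sub_add_closed: "\<lbrakk>x \<in> S; y \<in> S\<rbrakk> \<Longrightarrow> add R x y \<in> S"
    and sub_mul_closed: "\<lbrakk>x \<in> S; y \<in> S\<rbrakk> \<Longrightarrow> mul R x y \<in> S"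

locale right_ideal = semiring_on R for I :: "'a set" and R +
  assumes ideal_nonempty: "I \<noteq> {}"
    and ideal_subset: "I \<subseteq> carrier R"
    and ideal_add_closed: "\<lbrakk>x \<in> I; y \<in> I\<rbrakk> \<Longrightarrow> add R x y \<in> I"
    and ideal_mul_right: "\<lbrakk>x \<in> I; r \<in> carrier R\<rbrakk> \<Longrightarrow> mul R x r \<in> I"

locale ideal = right_ideal I R for I :: "'a set" and R +
  assumes ideal_mul_left: "\<lbrakk>x \<in> I; r \<in> carrier R\<rbrakk> \<Longrightarrow> mul R r x \<in> I"

definition is_zero :: "'a semiring_struct \<Rightarrow> 'a \<Rightarrow> bool" where
  "is_zero R z \<longleftrightarrow> z \<in> carrier R \<and>
     (\<forall>x\<in>carrier R. add R z x = x \<and> add R x z = x \<and> mul R z x = z \<and> mul R x z = z)"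

text \<open>Zero-divisors are two-sided in the weak sense: a left or a right zero-divisor.\<close>

definition zero_divisor :: "'a semiring_struct \<Rightarrow> 'a \<Rightarrow> 'a \<Rightarrow> bool" where
  "zero_divisor R z a \<longleftrightarrow> a \<in> carrier R \<and> a \<noteq> z \<and>
     (\<exists>b\<in>carrier R. b \<noteq> z \<and> (mul R a b = z \<or> mul R b a = z))"


subsection \<open>The lattices \<open>\<lozenge>\<^sub>n\<close>\<close>

text \<open>
  The type below, with countably many atoms, is only an ambient bounded lattice;
  \<open>\<lozenge>\<^sub>n\<close> is its bounded sublattice \<open>lozenge n\<close> with the atoms
  \<open>Atom 1, ..., Atom (n - 2)\<close>.
\<close>

datatype loz = Zero | Atom nat | One

instantiation loz :: bounded_lattice
begin

definition bot_loz :: loz where "bot_loz = Zero"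
definition top_loz :: loz where "top_loz = One"
definition less_eq_loz :: "loz \<Rightarrow> loz \<Rightarrow> bool" where
  "less_eq_loz x y \<longleftrightarrow> x = Zero \<or> y = One \<or> x = y"
definition less_loz :: "loz \<Rightarrow> loz \<Rightarrow> bool" where
  "less_loz x y \<longleftrightarrow> x \<le> y \<and> x \<noteq> y"
definition sup_loz :: "loz \<Rightarrow> loz \<Rightarrow> loz" where
  "sup_loz x y = (if x \<le> y then y else if y \<le> x then x else One)"
definition inf_loz :: "loz \<Rightarrow> loz \<Rightarrow> loz" where
  "inf_loz x y = (if x \<le> y then x else if y \<le> x then y else Zero)"

instance
  by standard
    (auto simp: bot_loz_def top_loz_def less_eq_loz_def less_loz_def sup_loz_def inf_loz_def)

end

definition lozenge :: "nat \<Rightarrow> loz set" where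
  "lozenge n = {bot, top} \<union> Atom ` {1..n - 2}"

lemma card_lozenge: "2 \<le> n \<Longrightarrow> card (lozenge n) = n"
proof -
  assume n: "2 \<le> n"
  have "card ({bot, top} \<union> Atom ` {1..n - 2}) = card {bot, top :: loz} + card (Atom ` {1..n - 2})"
    by (rule card_Un_disjoint) (auto simp: bot_loz_def top_loz_def)
  also have "card (Atom ` {1..n - 2}) = n - 2"
    by (subst card_image) (auto simp: inj_on_def)
  finally show ?thesis
    using n by (simp add: lozenge_def bot_loz_def top_loz_def)
qed

lemma sup_lozenge_closed: "x \<in> lozenge n \<Longrightarrow> y \<in> lozenge n \<Longrightarrow> sup x y \<in> lozenge n"
  by (auto simp: lozenge_def sup_loz_def top_loz_def)

lemma inf_lozenge_closed: "x \<in> lozenge n \<Longrightarrow> y \<in> lozenge n \<Longrightarrow> inf x y \<in> lozenge n"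
  by (auto simp: lozenge_def inf_loz_def bot_loz_def)


subsection \<open>The endomorphism semiring and its distinguished subsets\<close>

text \<open>
  Maps on \<open>\<lozenge>\<^sub>n\<close> are extensional functions on the carrier, so that HOL equality is equality of
  maps. Products are read from left to right: \<open>(\<alpha> \<cdot> \<beta>)(x) = \<beta>(\<alpha>(x))\<close>.
\<close>

definition End_loz :: "nat \<Rightarrow> (loz \<Rightarrow> loz) semiring_struct" where
  "End_loz n =
    \<lparr>carrier = {\<alpha> \<in> lozenge n \<rightarrow>\<^sub>E lozenge n.
        (\<forall>x\<in>lozenge n. \<forall>y\<in>lozenge n. \<alpha> (sup x y) = sup (\<alpha> x) (\<alpha> y)) \<and> \<alpha> bot = bot},
     add = (\<lambda>\<alpha> \<beta>. \<lambda>x\<in>lozenge n. sup (\<alpha> x) (\<beta> x)),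
     mul = (\<lambda>\<alpha> \<beta>. \<lambda>x\<in>lozenge n. \<beta> (\<alpha> x))\<rparr>"

definition almost_const :: "nat \<Rightarrow> loz \<Rightarrow> (loz \<Rightarrow> loz)" where
  "almost_const n c = (\<lambda>x\<in>lozenge n. if x = bot then bot else c)"

definition AC :: "nat \<Rightarrow> (loz \<Rightarrow> loz) set" where
  "AC n = almost_const n ` lozenge n"

definition Reg :: "nat \<Rightarrow> (loz \<Rightarrow> loz) set" where
  "Reg n = {\<alpha> \<in> carrier (End_loz n).
     \<alpha> \<noteq> almost_const n bot \<and> \<not> zero_divisor (End_loz n) (almost_const n bot) \<alpha>}"

definition ID_Reg :: "nat \<Rightarrow> (loz \<Rightarrow> loz) set" where
  "ID_Reg n = {\<alpha> \<in> Reg n. mul (End_loz n) \<alpha> \<alpha> = \<alpha>}"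

definition ID_Reg_hat :: "nat \<Rightarrow> (loz \<Rightarrow> loz) set" where
  "ID_Reg_hat n = ID_Reg n \<union> AC n"

lemma almost_const_bot: "almost_const n bot = (\<lambda>x\<in>lozenge n. bot)"
  by (simp add: almost_const_def)

lemma is_zero_End_loz: "is_zero (End_loz n) (almost_const n bot)"
  unfolding is_zero_def
proof (intro conjI ballI)
  have bot: "bot \<in> lozenge n"
    by (simp add: lozenge_def)
  show "almost_const n bot \<in> carrier (End_loz n)"
    by (simp add: End_loz_def almost_const_bot bot sup_lozenge_closed)
  fix \<alpha> assume "\<alpha> \<in> carrier (End_loz n)"
  then have ext: "\<alpha> \<in> extensional (lozenge n)" and maps: "\<And>x. x \<in> lozenge n \<Longrightarrow> \<alpha> x \<in> lozenge n"
    and \<alpha>_bot: "\<alpha> bot = bot"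
    by (auto simp: End_loz_def PiE_iff)
  show "add (End_loz n) (almost_const n bot) \<alpha> = \<alpha>" "add (End_loz n) \<alpha> (almost_const n bot) = \<alpha>"
    by (rule extensionalityI[OF _ ext]; simp add: End_loz_def almost_const_bot)+
  show "mul (End_loz n) (almost_const n bot) \<alpha> = almost_const n bot"
    by (rule extensionalityI[of _ "lozenge n"]; simp add: End_loz_def almost_const_bot \<alpha>_bot)
  show "mul (End_loz n) \<alpha> (almost_const n bot) = almost_const n bot"
    by (rule extensionalityI[of _ "lozenge n"]; simp add: End_loz_def almost_const_bot maps)
qed

end

theory Submission
  imports Defs
begin

text \<open>
  A regular endomorphism kills no nonzero element and fixes the top: otherwise it annihilates an
  almost constant map on one side, respectively a map with kernel \<open>{x. x \<le> \<alpha> 1}\<close> on the other.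
  If such an \<open>\<alpha>\<close> is idempotent and moves an atom \<open>a\<close> to another atom \<open>b\<close>, then \<open>b\<close> is
  fixed and \<open>1 = \<alpha> (a \<or> b) = b\<close>, which is absurd. So the regular idempotents are exactly the
  endomorphisms sending each nonzero element to itself or to \<open>1\<close>, and the closure properties
  can be read off this description.
\<close>

section \<open>Joins in the lozenge and the endomorphism semiring\<close>

lemma sup_loz_distinct:
  fixes x y :: loz
  assumes "x \<noteq> bot" "y \<noteq> bot" "x \<noteq> y"
  shows "sup x y = top"
  using assms by (auto simp: sup_loz_def less_eq_loz_def bot_loz_def top_loz_def)

lemma bot_in_lozenge [simp]: "bot \<in> lozenge n"
  and top_in_lozenge [simp]: "top \<in> lozenge n"
  by (simp_all add: lozenge_def)

lemma top_neq_bot_loz [simp]: "(top :: loz) \<noteq> bot" "(bot :: loz) \<noteq> top"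
  by (simp_all add: top_loz_def bot_loz_def)

lemmas [simp] = sup_lozenge_closed

lemma End_loz_carrier_iff:
  "\<alpha> \<in> carrier (End_loz n) \<longleftrightarrow> \<alpha> \<in> extensional (lozenge n) \<and>
    (\<forall>x\<in>lozenge n. \<alpha> x \<in> lozenge n) \<and>
    (\<forall>x\<in>lozenge n. \<forall>y\<in>lozenge n. \<alpha> (sup x y) = sup (\<alpha> x) (\<alpha> y)) \<and> \<alpha> bot = bot"
  by (auto simp: End_loz_def PiE_iff)

lemma add_End_loz: "add (End_loz n) \<alpha> \<beta> = (\<lambda>x\<in>lozenge n. sup (\<alpha> x) (\<beta> x))"
  and mul_End_loz: "mul (End_loz n) \<alpha> \<beta> = (\<lambda>x\<in>lozenge n. \<beta> (\<alpha> x))"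
  by (simp_all add: End_loz_def)

lemma End_loz_eqI:
  assumes "\<alpha> \<in> carrier (End_loz n)" "\<beta> \<in> carrier (End_loz n)"
    and "\<And>x. x \<in> lozenge n \<Longrightarrow> \<alpha> x = \<beta> x"
  shows "\<alpha> = \<beta>"
  using assms by (auto simp: End_loz_carrier_iff intro: extensionalityI)

lemma almost_const_carrier: "c \<in> lozenge n \<Longrightarrow> almost_const n c \<in> carrier (End_loz n)"
  by (auto simp: End_loz_carrier_iff almost_const_def)

lemma almost_const_eq_iff: "almost_const n c = almost_const n d \<longleftrightarrow> c = d"
proof
  assume "almost_const n c = almost_const n d"
  from fun_cong[OF this, of top] show "c = d"
    by (simp add: almost_const_def)
qed simp

lemma add_End_loz_closed:
  assumes "\<alpha> \<in> carrier (End_loz n)" "\<beta> \<in> carrier (End_loz n)"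
  shows "add (End_loz n) \<alpha> \<beta> \<in> carrier (End_loz n)"
  using assms by (auto simp: End_loz_carrier_iff add_End_loz sup.left_commute sup.assoc)

lemma mul_End_loz_closed:
  assumes "\<alpha> \<in> carrier (End_loz n)" "\<beta> \<in> carrier (End_loz n)"
  shows "mul (End_loz n) \<alpha> \<beta> \<in> carrier (End_loz n)"
  using assms by (auto simp: End_loz_carrier_iff mul_End_loz)

lemma semiring_on_End_loz: "semiring_on (End_loz n)"
proof
  show "carrier (End_loz n) \<noteq> {}"
    using almost_const_carrier[OF bot_in_lozenge] by blast
next
  \<comment> \<open>As products are read from left to right, \<open>z\<close> is applied last, so
    this law is join preservation of \<open>z\<close>. The other distributive law is the pointwise
    sum evaluated at the values of \<open>x\<close>.\<close>
  fix x y z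
  assume "x \<in> carrier (End_loz n)" "y \<in> carrier (End_loz n)" "z \<in> carrier (End_loz n)"
  then show "mul (End_loz n) (add (End_loz n) x y) z
      = add (End_loz n) (mul (End_loz n) x z) (mul (End_loz n) y z)"
    by (auto simp: add_End_loz mul_End_loz End_loz_carrier_iff intro!: restrict_ext)
next
  fix x y z
  assume "x \<in> carrier (End_loz n)"
  then show "mul (End_loz n) x (add (End_loz n) y z)
      = add (End_loz n) (mul (End_loz n) x y) (mul (End_loz n) x z)"
    and "mul (End_loz n) (mul (End_loz n) x y) z = mul (End_loz n) x (mul (End_loz n) y z)"
    by (auto simp: add_End_loz mul_End_loz End_loz_carrier_iff intro!: restrict_ext)
qed (simp_all add: add_End_loz_closed mul_End_loz_closed,
    auto simp: add_End_loz ac_simps intro!: restrict_ext)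

section \<open>Regular endomorphisms\<close>

lemma Reg_nonzero:
  assumes "\<alpha> \<in> Reg n" "x \<in> lozenge n" "x \<noteq> bot"
  shows "\<alpha> x \<noteq> bot"
proof
  assume "\<alpha> x = bot"
  moreover have \<alpha>: "\<alpha> \<in> carrier (End_loz n)"
    using assms by (simp add: Reg_def)
  \<comment> \<open>The almost constant factor acts first, so \<alpha> is evaluated only at
    \<open>bot\<close> and \<open>x\<close>, and it sends both to \<open>bot\<close>.\<close>
  ultimately have "mul (End_loz n) (almost_const n x) \<alpha> = almost_const n bot"
    by (auto simp: mul_End_loz almost_const_def End_loz_carrier_iff intro!: restrict_ext)
  moreover have "almost_const n x \<noteq> almost_const n bot"
    using assms(3) by (simp add: almost_const_eq_iff)
  ultimately have "zero_divisor (End_loz n) (almost_const n bot) \<alpha>"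
    using \<alpha> assms almost_const_carrier[OF assms(2)]
    unfolding zero_divisor_def Reg_def by blast
  with assms show False
    by (simp add: Reg_def)
qed

lemma Reg_top:
  assumes "\<alpha> \<in> Reg n"
  shows "\<alpha> top = top"
proof (rule ccontr)
  assume nt: "\<alpha> top \<noteq> top"
  have \<alpha>: "\<alpha> \<in> carrier (End_loz n)"
    using assms by (simp add: Reg_def)
  \<comment> \<open>This preserves joins because a join lies below \<open>\<alpha> top\<close>
    exactly when both arguments do. It is nonzero because \<open>top\<close> does not lie below
    \<open>\<alpha> top\<close>.\<close>
  define \<beta> :: "loz \<Rightarrow> loz" where "\<beta> = (\<lambda>x\<in>lozenge n. if x \<le> \<alpha> top then bot else top)"
  have \<beta>: "\<beta> \<in> carrier (End_loz n)"
    by (auto simp: End_loz_carrier_iff \<beta>_def)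
  \<comment> \<open>Monotonicity puts the whole image of \<alpha> inside the kernel of
    \<beta>.\<close>
  have "\<alpha> x \<le> \<alpha> top" if "x \<in> lozenge n" for x
  proof -
    have "\<alpha> (sup x top) = sup (\<alpha> x) (\<alpha> top)"
      using \<alpha> that top_in_lozenge unfolding End_loz_carrier_iff by blast
    then show ?thesis
      by (simp add: sup.absorb_iff2)
  qed
  then have "mul (End_loz n) \<alpha> \<beta> = almost_const n bot"
    using \<alpha> by (auto simp: mul_End_loz \<beta>_def almost_const_def End_loz_carrier_iff
        intro!: restrict_ext)
  moreover have "\<beta> \<noteq> almost_const n bot"
  proof
    assume "\<beta> = almost_const n bot"
    from fun_cong[OF this, of top] show False
      using nt by (simp add: \<beta>_def almost_const_def top_unique)
  qed
  ultimately have "zero_divisor (End_loz n) (almost_const n bot) \<alpha>"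
    using \<alpha> \<beta> assms unfolding zero_divisor_def Reg_def by blast
  with assms show False
    by (simp add: Reg_def)
qed

text \<open>Converse to \<open>Reg_nonzero\<close> and \<open>Reg_top\<close>. Fixing
  \<open>top\<close> turns \<open>\<alpha> \<beta> = 0\<close> into
  \<open>\<beta> top = bot\<close>, which forces \<beta> to vanish by monotonicity; killing no
  nonzero element turns \<open>\<beta> \<alpha> = 0\<close> into vanishing of every
  \<open>\<beta> x\<close>.\<close>

lemma RegI:
  assumes \<alpha>: "\<alpha> \<in> carrier (End_loz n)" and top: "\<alpha> top = top"
    and nonzero: "\<And>x. x \<in> lozenge n \<Longrightarrow> x \<noteq> bot \<Longrightarrow> \<alpha> x \<noteq> bot"
  shows "\<alpha> \<in> Reg n"
proof -
  have "\<alpha> \<noteq> almost_const n bot"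
    using top by (auto simp: almost_const_def)
  moreover have "\<beta> = almost_const n bot"
    if \<beta>: "\<beta> \<in> carrier (End_loz n)" and "mul (End_loz n) \<alpha> \<beta> = almost_const n bot" for \<beta>
  proof -
    have "\<beta> (\<alpha> top) = bot"
      using fun_cong[OF that(2), of top] by (simp add: mul_End_loz almost_const_def)
    then have bot: "\<beta> top = bot"
      by (simp add: top)
    have "\<beta> x = bot" if "x \<in> lozenge n" for x
    proof -
      have "\<beta> (sup x top) = sup (\<beta> x) (\<beta> top)"
        using \<beta> that top_in_lozenge unfolding End_loz_carrier_iff by blast
      then show ?thesis
        by (simp add: bot)
    qed
    then show ?thesis
      by (intro End_loz_eqI[OF \<beta> almost_const_carrier]) (auto simp: almost_const_def)
  qed
  moreover have "\<beta> = almost_const n bot"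
    if \<beta>: "\<beta> \<in> carrier (End_loz n)" and eq: "mul (End_loz n) \<beta> \<alpha> = almost_const n bot" for \<beta>
  proof (rule End_loz_eqI[OF \<beta> almost_const_carrier])
    fix x assume x: "x \<in> lozenge n"
    have "\<alpha> (\<beta> x) = bot"
      using fun_cong[OF eq, of x] x by (simp add: mul_End_loz almost_const_def)
    then show "\<beta> x = almost_const n bot x"
      using nonzero[of "\<beta> x"] \<beta> x by (auto simp: End_loz_carrier_iff almost_const_def)
  qed simp
  ultimately show ?thesis
    using \<alpha> unfolding Reg_def zero_divisor_def by blast
qed

section \<open>Pointwise description of the regular idempotents\<close>

lemma ID_Reg_iff:
  "\<alpha> \<in> ID_Reg n \<longleftrightarrow>
    \<alpha> \<in> carrier (End_loz n) \<and> (\<forall>x\<in>lozenge n. x \<noteq> bot \<longrightarrow> \<alpha> x = x \<or> \<alpha> x = top)"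
proof
  assume "\<alpha> \<in> ID_Reg n"
  then have reg: "\<alpha> \<in> Reg n" and idem: "mul (End_loz n) \<alpha> \<alpha> = \<alpha>"
    by (simp_all add: ID_Reg_def)
  then have \<alpha>: "\<alpha> \<in> carrier (End_loz n)"
    by (simp add: Reg_def)
  have "\<alpha> x = top" if x: "x \<in> lozenge n" "x \<noteq> bot" "\<alpha> x \<noteq> x" for x
  proof -
    have "\<alpha> (\<alpha> x) = \<alpha> x"
      using fun_cong[OF idem, of x] x by (simp add: mul_End_loz)
    \<comment> \<open>Two distinct nonzero elements join to \<open>top\<close>. Applying \<alpha> to
      this join gives \<open>top\<close> on one side and, by idempotence, \<open>\<alpha> x\<close>
      on the other.\<close>
    moreover have "sup x (\<alpha> x) = top"
      using x Reg_nonzero[OF reg x(1,2)] by (intro sup_loz_distinct) auto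
    moreover have "\<alpha> (sup x (\<alpha> x)) = sup (\<alpha> x) (\<alpha> (\<alpha> x))"
      using \<alpha> x(1) unfolding End_loz_carrier_iff by blast
    ultimately show ?thesis
      using Reg_top[OF reg] by simp
  qed
  with \<alpha> show "\<alpha> \<in> carrier (End_loz n) \<and> (\<forall>x\<in>lozenge n. x \<noteq> bot \<longrightarrow> \<alpha> x = x \<or> \<alpha> x = top)"
    by blast
next
  assume "\<alpha> \<in> carrier (End_loz n) \<and> (\<forall>x\<in>lozenge n. x \<noteq> bot \<longrightarrow> \<alpha> x = x \<or> \<alpha> x = top)"
  then have \<alpha>: "\<alpha> \<in> carrier (End_loz n)"
    and *: "\<And>x. x \<in> lozenge n \<Longrightarrow> x \<noteq> bot \<Longrightarrow> \<alpha> x = x \<or> \<alpha> x = top"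
    by blast+
  \<comment> \<open>Both alternatives coincide at \<open>top\<close>.\<close>
  have top: "\<alpha> top = top"
    using *[of top] by simp
  have "\<alpha> (\<alpha> x) = \<alpha> x" if "x \<in> lozenge n" for x
    using *[OF that] top \<alpha> by (cases "x = bot") (auto simp: End_loz_carrier_iff)
  then have "mul (End_loz n) \<alpha> \<alpha> = \<alpha>"
    by (intro End_loz_eqI[OF mul_End_loz_closed[OF \<alpha> \<alpha>] \<alpha>]) (simp add: mul_End_loz)
  moreover have "\<alpha> \<in> Reg n"
    using * top by (intro RegI[OF \<alpha>]) force+
  ultimately show "\<alpha> \<in> ID_Reg n"
    by (simp add: ID_Reg_def)
qed

section \<open>Almost constant maps\<close>

lemma add_almost_const:
  "add (End_loz n) (almost_const n c) (almost_const n d) = almost_const n (sup c d)"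
  by (auto simp: add_End_loz almost_const_def intro!: restrict_ext)

lemma almost_const_mul:
  assumes "\<alpha> \<in> carrier (End_loz n)" "c \<in> lozenge n"
  shows "mul (End_loz n) (almost_const n c) \<alpha> = almost_const n (\<alpha> c)"
  using assms by (auto simp: End_loz_carrier_iff mul_End_loz almost_const_def intro!: restrict_ext)

text \<open>A regular \<alpha> sends nonzero elements to nonzero elements, on all of which the
  second factor takes the value \<open>c\<close>. A map killing some but not all nonzero elements
  would, for \<open>c\<close> different from \<open>bot\<close>, give a product that is not almost
  constant; this is why \<open>AC n\<close> becomes a two-sided ideal only in the smaller
  semiring.\<close>

lemma mul_almost_const:
  assumes "\<alpha> \<in> ID_Reg n"
  shows "mul (End_loz n) \<alpha> (almost_const n c) = almost_const n c"
proof -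
  have "\<alpha> bot = bot" "\<And>x. x \<in> lozenge n \<Longrightarrow> \<alpha> x \<in> lozenge n"
    using assms by (auto simp: ID_Reg_iff End_loz_carrier_iff)
  moreover have "\<alpha> x \<noteq> bot" if "x \<in> lozenge n" "x \<noteq> bot" for x
    using assms Reg_nonzero that by (auto simp: ID_Reg_def)
  ultimately show ?thesis
    by (auto simp: mul_End_loz almost_const_def intro!: restrict_ext)
qed

lemma AC_subset: "AC n \<subseteq> carrier (End_loz n)"
  by (auto simp: AC_def almost_const_carrier)

text \<open>Under \<open>almost_const n\<close>, sums correspond to joins and right multiplication
  by \<open>r\<close> to applying \<open>r\<close>, so closure reduces to that of
  \<open>lozenge n\<close>.\<close>

lemma right_ideal_AC: "right_ideal (AC n) (End_loz n)"
proof -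
  interpret semiring_on "End_loz n"
    by (rule semiring_on_End_loz)
  show ?thesis
  proof
    show "AC n \<noteq> {}"
      using bot_in_lozenge unfolding AC_def by blast
    show "AC n \<subseteq> carrier (End_loz n)"
      by (rule AC_subset)
  next
    fix x y assume "x \<in> AC n" "y \<in> AC n"
    then show "add (End_loz n) x y \<in> AC n"
      by (auto simp: AC_def add_almost_const)
  next
    fix x r assume "x \<in> AC n" and r: "r \<in> carrier (End_loz n)"
    then obtain c where c: "c \<in> lozenge n" "x = almost_const n c"
      by (auto simp: AC_def)
    moreover have "r c \<in> lozenge n"
      using r c by (auto simp: End_loz_carrier_iff)
    ultimately show "mul (End_loz n) x r \<in> AC n"
      by (simp add: AC_def almost_const_mul[OF r])
  qed
qed

section \<open>Sums and products involving regular idempotents\<close>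

lemma add_ID_Reg:
  assumes "\<alpha> \<in> ID_Reg n" "\<beta> \<in> ID_Reg n"
  shows "add (End_loz n) \<alpha> \<beta> \<in> ID_Reg n"
proof -
  have "sup (\<alpha> x) (\<beta> x) = x \<or> sup (\<alpha> x) (\<beta> x) = top" if "x \<in> lozenge n" "x \<noteq> bot" for x
    using assms that unfolding ID_Reg_iff by (metis sup.idem sup_top_left sup_top_right)
  moreover have "add (End_loz n) \<alpha> \<beta> \<in> carrier (End_loz n)"
    using assms by (simp add: ID_Reg_iff add_End_loz_closed)
  ultimately show ?thesis
    by (simp add: ID_Reg_iff add_End_loz)
qed

lemma mul_ID_Reg:
  assumes "\<alpha> \<in> ID_Reg n" "\<beta> \<in> ID_Reg n"
  shows "mul (End_loz n) \<alpha> \<beta> \<in> ID_Reg n"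
proof -
  \<comment> \<open>If \<alpha> fixes \<open>x\<close>, the description of \<beta> at
    \<open>x\<close> applies; otherwise \<open>\<alpha> x = top\<close>, which \<beta>
    fixes.\<close>
  have "\<beta> (\<alpha> x) = x \<or> \<beta> (\<alpha> x) = top" if "x \<in> lozenge n" "x \<noteq> bot" for x
    using assms that unfolding ID_Reg_iff by (metis top_in_lozenge top_neq_bot_loz(1))
  moreover have "mul (End_loz n) \<alpha> \<beta> \<in> carrier (End_loz n)"
    using assms by (simp add: ID_Reg_iff mul_End_loz_closed)
  ultimately show ?thesis
    by (simp add: ID_Reg_iff mul_End_loz)
qed

text \<open>Mixed sums fall among the regular idempotents: joining \<open>c\<close> to a fixed
  nonzero \<open>x\<close> leaves \<open>x\<close> if \<open>c\<close> is \<open>bot\<close> or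
  \<open>x\<close>, and otherwise yields \<open>top\<close>; a value \<open>top\<close> stays
  \<open>top\<close>.\<close>

lemma add_ID_Reg_AC:
  assumes \<alpha>: "\<alpha> \<in> ID_Reg n" and c: "c \<in> lozenge n"
  shows "add (End_loz n) \<alpha> (almost_const n c) \<in> ID_Reg n"
proof -
  have "sup (\<alpha> x) c = x \<or> sup (\<alpha> x) c = top" if "x \<in> lozenge n" "x \<noteq> bot" for x
  proof (cases "\<alpha> x = top \<or> c = bot \<or> c = x")
    case True
    then show ?thesis
      using \<alpha> that by (auto simp: ID_Reg_iff)
  next
    case False
    then have "\<alpha> x = x"
      using \<alpha> that by (auto simp: ID_Reg_iff)
    with False that show ?thesis
      using sup_loz_distinct[of x c] by auto
  qed
  then show ?thesis
    using \<alpha> c by (auto simp: ID_Reg_iff add_End_loz_closed almost_const_carrier)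
      (auto simp: add_End_loz almost_const_def)
qed

section \<open>The subsemiring, its ideal and its zero\<close>

lemma ID_Reg_hat_subset: "ID_Reg_hat n \<subseteq> carrier (End_loz n)"
  using AC_subset by (auto simp: ID_Reg_hat_def ID_Reg_iff)

text \<open>An almost constant left factor is covered by the right ideal property, a regular
  idempotent one by \<open>mul_almost_const\<close>. This serves both the mixed products in
  \<open>ID_Reg_hat n\<close> and left absorption by the ideal.\<close>

lemma mul_AC_left:
  assumes "\<alpha> \<in> ID_Reg_hat n" "\<beta> \<in> AC n"
  shows "mul (End_loz n) \<alpha> \<beta> \<in> AC n"
proof (cases "\<alpha> \<in> AC n")
  case True
  then show ?thesis
    using right_ideal.ideal_mul_right[OF right_ideal_AC] assms AC_subset by blast
next
  case False
  then show ?thesis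
    using assms by (auto simp: ID_Reg_hat_def AC_def mul_almost_const)
qed

lemma subsemiring_ID_Reg_hat: "subsemiring (ID_Reg_hat n) (End_loz n)"
proof -
  interpret right_ideal "AC n" "End_loz n"
    by (rule right_ideal_AC)
  show ?thesis
  proof
    show "ID_Reg_hat n \<noteq> {}"
      using ideal_nonempty by (simp add: ID_Reg_hat_def)
    show "ID_Reg_hat n \<subseteq> carrier (End_loz n)"
      by (rule ID_Reg_hat_subset)
  next
    fix x y assume xy: "x \<in> ID_Reg_hat n" "y \<in> ID_Reg_hat n"
    \<comment> \<open>Commutativity reduces mixed sums to the order of summands treated in
      \<open>add_ID_Reg_AC\<close>.\<close>
    then have "add (End_loz n) x y = add (End_loz n) y x"
      using ID_Reg_hat_subset by (intro add_comm) auto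
    with xy show "add (End_loz n) x y \<in> ID_Reg_hat n"
      using add_ID_Reg add_ID_Reg_AC ideal_add_closed
      unfolding ID_Reg_hat_def AC_def by (smt (verit) Un_iff imageE)
    show "mul (End_loz n) x y \<in> ID_Reg_hat n"
      using xy mul_ID_Reg mul_AC_left ideal_mul_right ID_Reg_hat_subset
      unfolding ID_Reg_hat_def by blast
  qed
qed

text \<open>Ideals are defined relative to the full carrier of a semiring, so the subsemiring has to
  be recast as a semiring with carrier \<open>S\<close>. The equational laws are inherited from
  \<open>R\<close>.\<close>

lemma (in subsemiring) semiring_on_sub: "semiring_on (R\<lparr>carrier := S\<rparr>)"
proof -
  have "x \<in> carrier R" if "x \<in> S" for x
    using that sub_subset by blast
  then show ?thesis
    by unfold_locales
      (auto simp: sub_nonempty sub_add_closed sub_mul_closed add_assoc mul_assoc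
        distrib_left distrib_right intro: add_comm)
qed

lemma ideal_AC: "ideal (AC n) ((End_loz n)\<lparr>carrier := ID_Reg_hat n\<rparr>)"
proof -
  interpret right_ideal "AC n" "End_loz n"
    by (rule right_ideal_AC)
  interpret hat: semiring_on "(End_loz n)\<lparr>carrier := ID_Reg_hat n\<rparr>"
    by (rule subsemiring.semiring_on_sub[OF subsemiring_ID_Reg_hat])
  show ?thesis
    using ID_Reg_hat_subset
    by unfold_locales
      (auto simp: ideal_nonempty ideal_add_closed mul_AC_left ID_Reg_hat_def
        intro: ideal_mul_right)
qed

lemma is_zero_ID_Reg_hat:
  "is_zero ((End_loz n)\<lparr>carrier := ID_Reg_hat n\<rparr>) (almost_const n bot)"
proof -
  have "almost_const n bot \<in> ID_Reg_hat n"
    by (simp add: ID_Reg_hat_def AC_def)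
  then show ?thesis
    using is_zero_End_loz[of n] ID_Reg_hat_subset[of n] by (auto simp: is_zero_def)
qed

theorem proposition6p3:
  fixes n :: nat
  assumes "n \<ge> 4"
  shows "subsemiring (ID_Reg_hat n) (End_loz n)
    \<and> (\<exists>z. is_zero ((End_loz n)\<lparr>carrier := ID_Reg_hat n\<rparr>) z)
    \<and> right_ideal (AC n) (End_loz n)
    \<and> ideal (AC n) ((End_loz n)\<lparr>carrier := ID_Reg_hat n\<rparr>)"
  using subsemiring_ID_Reg_hat is_zero_ID_Reg_hat right_ideal_AC ideal_AC by blast

end
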